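(* Let $A\in \mathrm{BPS}_{(r,p),(\ell,m)}^{n\times n}$ be a banded-plus-semiseparable matrix with lower bandwidth $\ell$ and lower semiseparable rank $r$. The upper triangular factor matrix $T\in\mathbb{R}^{n\times n}$ generated by the Compact WY representation $Q=I-VTV^\top$ of the orthogonal factor of the Householder QR factorization of $A$ is also a banded-plus-semiseparable matrix: $$T\in \mathrm{BPS}_{(0,\,r+\ell),\,(0,\,0)}^{n\times n}.$$ Specifically, $T$ has lower and upper bandwidth $0$ (its banded component is purely diagonal, equal to $\operatorname{diag}(\tau_1,\tau_2,\dots,\tau_{n-1},0)$), lower semiseparable rank $0$, and upper semiseparable rank bounded by $r+\ell$. That is, for any partition index $1\le k\le n-1$, the off-diagonal subblock satisfies $$\operatorname{rank}\big(T[1:k,\;k+1:n]\big)\le r+\ell .$$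
   Context: Notation: $M[a:b,c:d]$ is the submatrix of $M$ with rows $a,\dots,b$ and columns $c,\dots,d$. $\operatorname{tril}(M,-1)$ is the strictly lower triangular part of $M$ and $\operatorname{triu}(M,1)$ its strictly upper triangular part (other entries set to zero). Banded matrices: $\mathrm{BM}_{(\ell,m)}^{n\times n}$ is the set of $B=(b_{kj})\in\mathbb{R}^{n\times n}$ with $b_{kj}=0$ whenever $k-j>\ell$ or $j-k>m$. Banded-plus-semiseparable (BPS) matrices: $A\in \mathrm{BPS}_{(r,p),(\ell,m)}^{n\times n}$ if $A=B+\operatorname{tril}(UV^\top,-1)+\operatorname{triu}(WS^\top,1)$ for some $U,V\in\mathbb{R}^{n\times r}$, $W,S\in\mathbb{R}^{n\times p}$ and $B\in \mathrm{BM}_{(\ell,m)}^{n\times n}$ (a term with zero columns in its generators is absent). Householder QR: set $A^{(0)}=A$. For $k=1,\dots,n-1$ let $x=A^{(k-1)}[k:n,k]\in\mathbb{R}^{n-k+1}$ and $\alpha_k=\operatorname{sign}(x_1)\,\big|x_1+\operatorname{sign}(x_1)\|x\|_2\big|$. Let $v_k\in\mathbb{R}^n$ have entries $0$ in positions $1,\dots,k-1$, entry $1$ in position $k$, and entry $x_{i-k+1}/\alpha_k$ in positions $i=k+1,\dots,n$. Put $\tau_k=2\|v_k\|_2^{-2}$ and $A^{(k)}=(I-\tau_kv_kv_k^\top)A^{(k-1)}$. Then $A=QR$ with $R=A^{(n-1)}$ upper triangular and $Q=(I-\tau_1v_1v_1^\top)\cdots(I-\tau_{n-1}v_{n-1}v_{n-1}^\top)$.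 Compact WY factor: let $V=[v_1,\dots,v_{n-1}]\in\mathbb{R}^{n\times(n-1)}$. Define $T_1=[\tau_1]$ and, for $2\le j\le n-1$, $$T_j=\begin{bmatrix}T_{j-1}&\mathbf{z}_{j-1}\\ \mathbf{0}&\tau_j\end{bmatrix},\qquad \mathbf{z}_{j-1}=-\tau_jT_{j-1}V_{j-1}^\top v_j,\qquad V_{j-1}=[v_1,\dots,v_{j-1}]\in\mathbb{R}^{n\times(j-1)}.$$ Then $Q=I-VT_{n-1}V^\top$. The $n\times n$ matrix $T$ has leading principal submatrix $T[1:n-1,1:n-1]=T_{n-1}$ and zero last row and column (corresponding to $\tau_n=0$).
   Formalization: Membership of T in BPS is proved with semiseparable rank meaning the off-diagonal block rank bound, since with global generators it fails (e.g. A=diag(H,H,1), H=[3 4;4 -3]); sign(0)=1, and v_k=e_k when the column x is zero. *)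

theory Defs
  imports Complex_Main "Jordan_Normal_Form.DL_Rank" "Jordan_Normal_Form.DL_Submatrix"
begin

text \<open>
  Indices are 0-based: row, column and step \<open>k\<close> here is \<open>k + 1\<close> in the usual 1-based numbering.
  In particular the block with rows \<open>1, \<dots>, k\<close> and columns \<open>k + 1, \<dots>, n\<close> is
  \<open>submatrix M {0..<k} {k..<n}\<close>.
\<close>

definition mat_rank :: "real mat \<Rightarrow> nat" where
  "mat_rank M = vec_space.rank (dim_row M) M"

definition tril_strict :: "real mat \<Rightarrow> real mat" where
  "tril_strict M = mat (dim_row M) (dim_col M) (\<lambda>(i, j). if j < i then M $$ (i, j) else 0)"

definition triu_strict :: "real mat \<Rightarrow> real mat" where
  "triu_strict M = mat (dim_row M) (dim_col M) (\<lambda>(i, j). if i < j then M $$ (i, j) else 0)"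

definition BM :: "nat \<Rightarrow> nat \<Rightarrow> nat \<Rightarrow> real mat set" where
  "BM n l m = {B \<in> carrier_mat n n.
     \<forall>k<n. \<forall>j<n. k > j + l \<or> j > k + m \<longrightarrow> B $$ (k, j) = 0}"

definition BPS :: "nat \<Rightarrow> nat \<Rightarrow> nat \<Rightarrow> nat \<Rightarrow> nat \<Rightarrow> real mat set" where
  "BPS n r p l m =
     {B + tril_strict (U * V\<^sup>T) + triu_strict (W * S\<^sup>T) | B U V W S.
        B \<in> BM n l m \<and> U \<in> carrier_mat n r \<and> V \<in> carrier_mat n r \<and>
        W \<in> carrier_mat n p \<and> S \<in> carrier_mat n p}"

text \<open>
  The same class with the semiseparable ranks understood as bounds on the ranks of all
  off-diagonal blocks of the two triangular parts, instead of through one global pair of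
  generators for each part. It contains \<open>BPS n r p l m\<close>, strictly in general, and
  the distinction matters for the factor \<open>T\<close> of the compact WY representation. For
  \<open>H = (3, 4; 4, -3)\<close> and the 5-by-5 matrix \<open>A = diag (H, H, 1)\<close>, which lies in
  \<open>BPS 5 0 0 1 1\<close>, one gets \<open>v\<^sub>1 = e\<^sub>1 + e\<^sub>2 / 2\<close>, \<open>v\<^sub>2 = e\<^sub>2\<close>,
  \<open>v\<^sub>3 = e\<^sub>3 + e\<^sub>4 / 2\<close>, \<open>v\<^sub>4 = e\<^sub>4\<close> and hence (1-based)
  \<open>T\<^sub>1\<^sub>2 = T\<^sub>3\<^sub>4 = -8/5\<close>, \<open>T\<^sub>1\<^sub>4 = 0\<close>. All blocks above the diagonal have rank at most 1, but
  \<open>T\<close> is not in \<open>BPS 5 0 1 0 0\<close>: \<open>w\<^sub>1 s\<^sub>2 \<noteq> 0\<close> and \<open>w\<^sub>3 s\<^sub>4 \<noteq> 0\<close> contradict \<open>w\<^sub>1 s\<^sub>4 = 0\<close>.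
\<close>

definition BPS_rank :: "nat \<Rightarrow> nat \<Rightarrow> nat \<Rightarrow> nat \<Rightarrow> nat \<Rightarrow> real mat set" where
  "BPS_rank n r p l m =
     {B + tril_strict L + triu_strict R | B L R.
        B \<in> BM n l m \<and> L \<in> carrier_mat n n \<and> R \<in> carrier_mat n n \<and>
        (\<forall>k\<in>{1..<n}. mat_rank (submatrix L {k..<n} {0..<k}) \<le> r) \<and>
        (\<forall>k\<in>{1..<n}. mat_rank (submatrix R {0..<k} {k..<n}) \<le> p)}"

text \<open>The usual convention of Householder reflections: the sign of 0 is 1, unlike \<open>sgn\<close>.\<close>

definition hh_sign :: "real \<Rightarrow> real" where
  "hh_sign t = (if t < 0 then -1 else 1)"

definition norm2 :: "real vec \<Rightarrow> real" where
  "norm2 x = sqrt (x \<bullet> x)"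

definition hh_alpha :: "real vec \<Rightarrow> real" where
  "hh_alpha x = hh_sign (x $ 0) * \<bar>x $ 0 + hh_sign (x $ 0) * norm2 x\<bar>"

text \<open>
  Here \<open>hh_alpha x = 0\<close> only for \<open>x = 0\<close>; by \<open>0 / 0 = 0\<close> the vector is then the \<open>k\<close>-th unit
  vector, and the reflection still leaves column \<open>k\<close> zero from the diagonal downwards.
\<close>

definition hh_vec :: "nat \<Rightarrow> real mat \<Rightarrow> real vec" where
  "hh_vec k M =
     (let n = dim_row M; x = vec (n - k) (\<lambda>i. M $$ (k + i, k)) in
      vec n (\<lambda>i. if i < k then 0 else if i = k then 1 else x $ (i - k) / hh_alpha x))"

definition hh_coeff :: "real vec \<Rightarrow> real" where
  "hh_coeff v = 2 / (norm2 v)\<^sup>2"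

definition reflector :: "real vec \<Rightarrow> real mat" where
  "reflector v =
     (let n = dim_vec v in 1\<^sub>m n - hh_coeff v \<cdot>\<^sub>m (mat_of_cols n [v] * mat_of_rows n [v]))"

primrec hh_iter :: "real mat \<Rightarrow> nat \<Rightarrow> real mat" where
  "hh_iter A 0 = A"
| "hh_iter A (Suc k) = reflector (hh_vec k (hh_iter A k)) * hh_iter A k"

definition hh_v :: "real mat \<Rightarrow> nat \<Rightarrow> real vec" where
  "hh_v A k = hh_vec k (hh_iter A k)"

definition hh_tau :: "real mat \<Rightarrow> nat \<Rightarrow> real" where
  "hh_tau A k = hh_coeff (hh_v A k)"

definition hh_V :: "real mat \<Rightarrow> nat \<Rightarrow> real mat" where
  "hh_V A j = mat_of_cols (dim_row A) (map (hh_v A) [0..<j])"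

text \<open>
  \<open>wy_T_lead A j\<close> is the \<open>j\<close>-by-\<open>j\<close> matrix \<open>T\<^sub>j\<close>, started at the empty matrix, so that
  \<open>T\<^sub>1\<close> is the 1-by-1 matrix with entry \<open>hh_tau A 0\<close>.
\<close>

primrec wy_T_lead :: "real mat \<Rightarrow> nat \<Rightarrow> real mat" where
  "wy_T_lead A 0 = 0\<^sub>m 0 0"
| "wy_T_lead A (Suc j) =
     (let z = (- hh_tau A j) \<cdot>\<^sub>v (wy_T_lead A j *\<^sub>v ((hh_V A j)\<^sup>T *\<^sub>v hh_v A j)) in
      four_block_mat (wy_T_lead A j) (mat_of_cols j [z])
                     (0\<^sub>m 1 j) (mat 1 1 (\<lambda>_. hh_tau A j)))"

definition wy_T :: "real mat \<Rightarrow> real mat" where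
  "wy_T A =
     (let n = dim_row A in
      mat n n (\<lambda>(i, j). if i < n - 1 \<and> j < n - 1 then wy_T_lead A (n - 1) $$ (i, j) else 0))"

end

theory Submission
  imports Defs
begin

text \<open>
  Write \<open>V\<^sub>1\<close> for the first \<open>k\<close> Householder vectors and \<open>V\<^sub>2\<close> for the remaining ones, and split \<open>T\<close>
  accordingly. Since \<open>V\<^sub>2\<close> vanishes in the first \<open>k\<close> rows, the block
  \<open>T[1:k, k+1:n] = - T\<^sub>1\<^sub>1 V\<^sub>1\<^sup>T V\<^sub>2 T\<^sub>2\<^sub>2\<close> only sees the rows of \<open>V\<^sub>1\<close> below row \<open>k\<close>.
  Each reflection adds multiples of its Householder vector to the columns of the matrix, so
  the columns of that part of \<open>V\<^sub>1\<close> lie in the column space of \<open>A[k+1:n, 1:k]\<close>. The latter block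
  has rank at most \<open>r + l\<close>: the semiseparable part contributes \<open>r\<close>, and the band meets only its
  last \<open>l\<close> columns.
\<close>

section \<open>Span of a fixed family of generators, restricted to a set of rows\<close>

text \<open>Column-space membership is phrased with functions on original row indices, so that
  blocks can be treated without renumbering. The family \<open>g\<close> is a parameter: only
  generators shared by all columns of a block bound its rank by \<open>q\<close>.\<close>

definition generated_by :: "nat \<Rightarrow> (nat \<Rightarrow> nat \<Rightarrow> real) \<Rightarrow> nat set \<Rightarrow> (nat \<Rightarrow> real) \<Rightarrow> bool" where
  "generated_by q g I f \<longleftrightarrow> (\<exists>h. \<forall>i\<in>I. f i = (\<Sum>c<q. g i c * h c))"

lemma generated_byI:
  assumes "\<And>i. i \<in> I \<Longrightarrow> f i = (\<Sum>c<q. g i c * h c)"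
  shows "generated_by q g I f"
  using assms unfolding generated_by_def by blast

lemma generated_by_cong:
  assumes "generated_by q g I f" "\<And>i. i \<in> I \<Longrightarrow> f' i = f i"
  shows "generated_by q g I f'"
  using assms unfolding generated_by_def by simp

lemma generated_by_zero: "generated_by q g I (\<lambda>i. 0)"
  by (rule generated_byI[where h = "\<lambda>c. 0"]) simp

lemma generated_by_add:
  assumes "generated_by q g I f" "generated_by q g I f'"
  shows "generated_by q g I (\<lambda>i. f i + f' i)"
proof -
  obtain h h' where "\<forall>i\<in>I. f i = (\<Sum>c<q. g i c * h c)" "\<forall>i\<in>I. f' i = (\<Sum>c<q. g i c * h' c)"
    using assms unfolding generated_by_def by blast
  then show ?thesis
    by (intro generated_byI[where h = "\<lambda>c. h c + h' c"]) (simp add: distrib_left sum.distrib)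
qed

lemma generated_by_mult_right:
  assumes "generated_by q g I f"
  shows "generated_by q g I (\<lambda>i. f i * a)"
proof -
  obtain h where "\<forall>i\<in>I. f i = (\<Sum>c<q. g i c * h c)"
    using assms unfolding generated_by_def by blast
  then show ?thesis
    by (intro generated_byI[where h = "\<lambda>c. h c * a"]) (simp add: sum_distrib_right mult.assoc)
qed

lemma generated_by_sum:
  assumes "\<And>s. s \<in> S \<Longrightarrow> generated_by q g I (f s)"
  shows "generated_by q g I (\<lambda>i. \<Sum>s\<in>S. f s i)"
  using assms
  by (induction S rule: infinite_finite_induct) (auto intro: generated_by_zero generated_by_add)

section \<open>Rank bounds from common generators\<close>

lemma (in vec_space) rank_le_sum_product_entries:
  fixes f g :: "nat \<Rightarrow> nat \<Rightarrow> 'a"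
  assumes "A \<in> carrier_mat n nc"
    and "\<And>i j. i < n \<Longrightarrow> j < nc \<Longrightarrow> A $$ (i, j) = (\<Sum>c<q. f i c * g c j)"
  shows "rank A \<le> q"
  using assms
proof (induction q arbitrary: A)
  case 0
  then have "A = 0\<^sub>m n nc" by (intro eq_matI) auto
  then show ?case by (simp add: rank_0I)
next
  case (Suc q)
  define B where "B = mat n nc (\<lambda>(i, j). \<Sum>c<q. f i c * g c j)"
  define C where "C = mat n nc (\<lambda>(i, j). f i q * g q j)"
  have "A = B + C" using Suc.prems by (intro eq_matI) (auto simp: B_def C_def)
  moreover have "rank B \<le> q" by (rule Suc.IH) (auto simp: B_def)
  moreover have "rank C \<le> 1"
    by (rule rank_le_1_product_entries[where nc = nc and f = "\<lambda>i. f i q" and g = "g q"])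
      (auto simp: C_def)
  moreover have "rank (B + C) \<le> rank B + rank C"
    by (rule rank_subadditive) (auto simp: B_def C_def)
  ultimately show ?case by simp
qed

text \<open>As \<open>g\<close> does not depend on \<open>j\<close>, the coefficient functions
  chosen for the single columns assemble into a factorization of the block with inner dimension
  \<open>q\<close>.\<close>

lemma mat_rank_submatrix_le:
  assumes "\<And>j. j \<in> J \<Longrightarrow> j < dim_col M \<Longrightarrow>
             generated_by q g {i \<in> I. i < dim_row M} (\<lambda>i. M $$ (i, j))"
  shows "mat_rank (submatrix M I J) \<le> q"
proof -
  have "\<forall>j\<in>{j \<in> J. j < dim_col M}. \<exists>h.
          \<forall>i\<in>{i \<in> I. i < dim_row M}. M $$ (i, j) = (\<Sum>c<q. g i c * h c)"
    using assms unfolding generated_by_def by blast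
  from bchoice[OF this] obtain h where h: "\<And>i j. i \<in> I \<Longrightarrow> i < dim_row M \<Longrightarrow> j \<in> J \<Longrightarrow>
      j < dim_col M \<Longrightarrow> M $$ (i, j) = (\<Sum>c<q. g i c * h j c)"
    by blast
  \<comment> \<open>\<open>submatrix\<close> renumbers rows and columns through \<open>pick\<close>;
    this keeps the original indices inside the sets where \<open>h\<close> is known to work.\<close>
  have pick: "pick S i \<in> S \<and> pick S i < N" if "i < card {a. a < N \<and> a \<in> S}" for S N i
    using pick_in_set_le[OF that] pick_reduce_set[OF that] by simp
  show ?thesis
    unfolding mat_rank_def
    by (rule vec_space.rank_le_sum_product_entries[where nc = "dim_col (submatrix M I J)"
          and f = "\<lambda>i c. g (pick I i) c" and g = "\<lambda>c j. h (pick J j) c"])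
      (auto simp: dim_submatrix submatrix_index h pick)
qed

section \<open>Householder vectors and the lower left block during the iteration\<close>

lemma hh_vec_dim [simp]: "dim_vec (hh_vec k M) = dim_row M"
  by (simp add: hh_vec_def Let_def)

lemma reflector_carrier [simp]: "reflector v \<in> carrier_mat (dim_vec v) (dim_vec v)"
  by (rule carrier_matI) (simp_all add: reflector_def Let_def)

lemma reflector_mult_index:
  assumes "M \<in> carrier_mat n nc" "dim_vec v = n" "i < n" "j < nc"
  shows "(reflector v * M) $$ (i, j) = M $$ (i, j) - hh_coeff v * (v \<bullet> col M j) * v $ i"
proof -
  have "(reflector v * M) $$ (i, j) = (\<Sum>s<n. reflector v $$ (i, s) * M $$ (s, j))"
    using assms reflector_carrier[of v]
    by (simp add: scalar_prod_def atLeast0LessThan)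
  also have "\<dots> = (\<Sum>s<n. (if i = s then M $$ (s, j) else 0) - hh_coeff v * v $ i * (v $ s * M $$ (s, j)))"
    using assms
    by (intro sum.cong)
      (auto simp: reflector_def Let_def mat_of_cols_def mat_of_rows_def scalar_prod_def algebra_simps)
  also have "\<dots> = M $$ (i, j) - hh_coeff v * v $ i * (\<Sum>s<n. v $ s * M $$ (s, j))"
    using assms by (simp add: sum_subtractf sum_distrib_left)
  finally show ?thesis
    using assms by (simp add: scalar_prod_def atLeast0LessThan mult.commute mult.left_commute)
qed

lemma hh_iter_carrier:
  assumes "A \<in> carrier_mat n n"
  shows "hh_iter A t \<in> carrier_mat n n"
proof (induction t)
  case (Suc t)
  then show ?case
    using reflector_carrier[of "hh_vec t (hh_iter A t)"] by auto
qed (simp add: assms)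

lemma hh_v_carrier:
  assumes "A \<in> carrier_mat n n"
  shows "hh_v A k \<in> carrier_vec n"
  using carrier_matD(1)[OF hh_iter_carrier[OF assms, of k]]
  by (intro carrier_vecI) (simp add: hh_v_def)

lemma hh_v_index_above:
  assumes "A \<in> carrier_mat n n" "i < k" "i < n"
  shows "hh_v A k $ i = 0"
  using assms hh_iter_carrier[OF assms(1), of k] by (auto simp: hh_v_def hh_vec_def Let_def)

text \<open>The scaling by \<open>hh_alpha\<close> is the same in all rows. Row \<open>k\<close> is
  excluded, since its entry is set to 1. If \<open>hh_alpha\<close> vanishes,
  \<open>inverse 0 = 0\<close> makes \<open>a = 0\<close> fit.\<close>

lemma hh_v_below_diagonal:
  assumes "A \<in> carrier_mat n n"
  obtains a where "\<And>i. k < i \<Longrightarrow> i < n \<Longrightarrow> hh_v A k $ i = hh_iter A k $$ (i, k) * a"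
proof
  show "hh_v A k $ i = hh_iter A k $$ (i, k) *
      inverse (hh_alpha (vec (n - k) (\<lambda>i. hh_iter A k $$ (k + i, k))))"
    if "k < i" "i < n" for i
    using that hh_iter_carrier[OF assms, of k]
    by (auto simp: hh_v_def hh_vec_def Let_def divide_inverse)
qed

text \<open>Step \<open>t < k\<close> adds multiples of the Householder vector to the columns. In
  the rows from \<open>k\<close> on, all strictly below the pivot row \<open>t\<close>, this vector
  is a multiple of the current column \<open>t\<close>, itself one of the first \<open>k\<close>
  columns. Hence the span of the block does not grow.\<close>

lemma hh_iter_block_generated:
  assumes A: "A \<in> carrier_mat n n" and "k \<le> n" "t \<le> k"
    and gen: "\<And>j. j < k \<Longrightarrow> generated_by q g {k..<n} (\<lambda>i. A $$ (i, j))"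
  shows "\<forall>j<k. generated_by q g {k..<n} (\<lambda>i. hh_iter A t $$ (i, j))"
  using \<open>t \<le> k\<close>
proof (induction t)
  case (Suc t)
  let ?M = "hh_iter A t"
  have M: "?M \<in> carrier_mat n n" by (rule hh_iter_carrier[OF A])
  have IH: "generated_by q g {k..<n} (\<lambda>i. ?M $$ (i, j))" if "j < k" for j
    using Suc that by simp
  obtain a where a: "\<And>i. t < i \<Longrightarrow> i < n \<Longrightarrow> hh_v A t $ i = ?M $$ (i, t) * a"
    using hh_v_below_diagonal[OF A] by blast
  show ?case
  proof (intro allI impI)
    fix j assume "j < k"
    let ?b = "hh_coeff (hh_v A t) * (hh_v A t \<bullet> col ?M j)"
    have "generated_by q g {k..<n} (\<lambda>i. ?M $$ (i, j) + ?M $$ (i, t) * (- a * ?b))"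
      using \<open>j < k\<close> Suc.prems by (intro generated_by_add generated_by_mult_right IH) auto
    moreover have "hh_iter A (Suc t) $$ (i, j) = ?M $$ (i, j) + ?M $$ (i, t) * (- a * ?b)"
      if "i \<in> {k..<n}" for i
      using reflector_mult_index[OF M, of "hh_v A t" i j] hh_v_carrier[OF A, of t] that \<open>j < k\<close>
        Suc.prems a[of i] M by (simp add: hh_v_def algebra_simps)
    ultimately show "generated_by q g {k..<n} (\<lambda>i. hh_iter A (Suc t) $$ (i, j))"
      by (rule generated_by_cong)
  qed
qed (use gen in simp)

lemma hh_v_generated:
  assumes A: "A \<in> carrier_mat n n" and "k \<le> n" "s < k"
    and gen: "\<And>j. j < k \<Longrightarrow> generated_by q g {k..<n} (\<lambda>i. A $$ (i, j))"
  shows "generated_by q g {k..<n} (\<lambda>i. hh_v A s $ i)"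
proof -
  obtain a where a: "\<And>i. s < i \<Longrightarrow> i < n \<Longrightarrow> hh_v A s $ i = hh_iter A s $$ (i, s) * a"
    using hh_v_below_diagonal[OF A] by blast
  have "generated_by q g {k..<n} (\<lambda>i. hh_iter A s $$ (i, s) * a)"
    using hh_iter_block_generated[OF A \<open>k \<le> n\<close>, of s q g] gen \<open>s < k\<close>
    by (intro generated_by_mult_right) auto
  then show ?thesis
    by (rule generated_by_cong) (use a \<open>s < k\<close> in simp)
qed

section \<open>The lower left blocks of the given matrix\<close>

lemma BPS_lower_block_generated:
  assumes A: "A \<in> BPS n r p l m" and k: "k \<le> n"
  shows "\<exists>g. \<forall>j<k. generated_by (r + l) g {k..<n} (\<lambda>i. A $$ (i, j))"
proof -
  obtain B U V W S where eq: "A = B + tril_strict (U * V\<^sup>T) + triu_strict (W * S\<^sup>T)"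
    and B: "B \<in> BM n l m" and U: "U \<in> carrier_mat n r" and V: "V \<in> carrier_mat n r"
    and W: "W \<in> carrier_mat n p" and S: "S \<in> carrier_mat n p"
    using A unfolding BPS_def by blast
  have Bc: "B \<in> carrier_mat n n" using B by (simp add: BM_def)
  \<comment> \<open>Generator \<open>r + d\<close> is column \<open>k - 1 - d\<close> of
    \<open>B\<close>, so \<open>d < l\<close> runs backwards through the \<open>l\<close> columns
    left of the cut. For \<open>d \<ge> k\<close> truncated subtraction gives column 0, harmlessly:
    \<open>h\<close> is then 0.\<close>
  define g where "g i c = (if c < r then U $$ (i, c) else B $$ (i, k - 1 - (c - r)))" for i c
  have "generated_by (r + l) g {k..<n} (\<lambda>i. A $$ (i, j))" if j: "j < k" for j
  proof (rule generated_byI)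
    fix i assume i: "i \<in> {k..<n}"
    define h where "h c = (if c < r then V $$ (j, c) else if c - r = k - 1 - j then 1 else 0)" for c
    have "A $$ (i, j) = B $$ (i, j) + (\<Sum>c<r. U $$ (i, c) * V $$ (j, c))"
      using i j k Bc U V W S unfolding eq
      by (simp add: tril_strict_def triu_strict_def scalar_prod_def atLeast0LessThan)
    also have "(\<Sum>c<r. U $$ (i, c) * V $$ (j, c)) = (\<Sum>c<r. g i c * h c)"
      by (simp add: g_def h_def)
    also have "B $$ (i, j) = (\<Sum>d<l. g i (r + d) * h (r + d))"
    proof -
      have "(\<Sum>d<l. g i (r + d) * h (r + d))
          = (\<Sum>d<l. if d = k - 1 - j then B $$ (i, j) else 0)"
        using j by (intro sum.cong) (auto simp: g_def h_def)
      \<comment> \<open>If \<open>d = k - 1 - j\<close> is outside the range of summation, then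
        \<open>j + l < k \<le> i\<close>, and the entry lies outside the band.\<close>
      also have "\<dots> = B $$ (i, j)"
        using B i j k by (auto simp: BM_def)
      finally show ?thesis by simp
    qed
    also have "(\<Sum>d<l. g i (r + d) * h (r + d)) + (\<Sum>c<r. g i c * h c)
        = (\<Sum>c<r + l. g i c * h c)"
      by (induction l) simp_all
    finally show "A $$ (i, j) = (\<Sum>c<r + l. g i c * h c)" .
  qed
  then show ?thesis by blast
qed

section \<open>Entries and upper right blocks of the compact WY factor\<close>

lemma wy_T_lead_carrier: "wy_T_lead A N \<in> carrier_mat N N"
  by (induction N) (auto simp: Let_def)

text \<open>Later steps only border the matrix, so the entries of \<open>T\<^sub>j\<close> may be
  read off the larger \<open>T\<^sub>N\<close>. This gives a recursion over the columns of one fixed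
  matrix.\<close>

lemma wy_T_lead_index:
  assumes A: "A \<in> carrier_mat n n" and "i < N" "j < N"
  shows "wy_T_lead A N $$ (i, j) =
    (if i = j then hh_tau A j
     else if j < i then 0
     else (\<Sum>s<j. wy_T_lead A N $$ (i, s) * (hh_v A s \<bullet> hh_v A j)) * - hh_tau A j)"
  using assms(2,3)
proof (induction N arbitrary: i j)
  case (Suc N)
  let ?T = "wy_T_lead A N"
  let ?u = "(hh_V A N)\<^sup>T *\<^sub>v hh_v A N"
  have T: "?T \<in> carrier_mat N N" by (rule wy_T_lead_carrier)
  have V: "hh_V A N \<in> carrier_mat n N" using A mat_of_cols_carrier(1)[of n "map (hh_v A) [0..<N]"] by (simp add: hh_V_def)
  have u: "?u $ s = hh_v A s \<bullet> hh_v A N" if "s < N" for s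
    using that V A hh_v_carrier[OF A] by (simp add: hh_V_def)
  have old: "wy_T_lead A (Suc N) $$ (i, j) = ?T $$ (i, j)" if "i < N" "j < N" for i j
    using that T by (simp add: Let_def)
  have new: "wy_T_lead A (Suc N) $$ (i, N)
      = (\<Sum>s<N. ?T $$ (i, s) * (hh_v A s \<bullet> hh_v A N)) * - hh_tau A N" if "i < N" for i
  proof -
    have "(?T *\<^sub>v ?u) $ i = (\<Sum>s<N. ?T $$ (i, s) * (hh_v A s \<bullet> hh_v A N))"
      using that T V u by (simp add: scalar_prod_def[of "row ?T i"] atLeast0LessThan)
    then show ?thesis using that T by (simp add: Let_def mat_of_cols_def)
  qed
  consider "i < N" "j < N" | "i < N" "j = N" | "i = N" "j < N" | "i = N" "j = N"
    using Suc.prems by linarith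
  then show ?case
  proof cases
    case 1
    then show ?thesis using Suc.IH[of i j] by (simp add: old del: wy_T_lead.simps)
  next
    case 2
    then show ?thesis by (simp add: old new del: wy_T_lead.simps)
  next
    case 3
    then show ?thesis using T by (simp add: Let_def)
  next
    case 4
    then show ?thesis using T by (simp add: Let_def)
  qed
qed simp

text \<open>Split the recursive sum at \<open>k\<close>. The terms with \<open>s < k\<close> pass
  through the factorization of \<open>p\<close> and hence through the \<open>q\<close> columns of
  \<open>T\<^sub>1\<^sub>1\<close> times \<open>w\<close>; the others are multiples of earlier
  columns right of the cut, covered by induction. The factor \<open>T\<^sub>2\<^sub>2\<close> thus
  never has to be written out.\<close>

lemma column_recursion_generated:
  fixes t :: "nat \<Rightarrow> nat \<Rightarrow> real"
  assumes rec: "\<And>i j. i < k \<Longrightarrow> k \<le> j \<Longrightarrow> j < N \<Longrightarrow> t i j = (\<Sum>s<j. t i s * p s j) * d j"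
    and fac: "\<And>s j. s < k \<Longrightarrow> k \<le> j \<Longrightarrow> j < N \<Longrightarrow> p s j = (\<Sum>c<q. w s c * u c j)"
    and "k \<le> j" "j < N"
  shows "generated_by q (\<lambda>i c. \<Sum>s<k. t i s * w s c) {0..<k} (\<lambda>i. t i j)"
  using \<open>k \<le> j\<close> \<open>j < N\<close>
proof (induction j rule: less_induct)
  case (less j)
  let ?gen = "generated_by q (\<lambda>i c. \<Sum>s<k. t i s * w s c) {0..<k}"
  have "?gen (\<lambda>i. \<Sum>s<k. t i s * p s j)"
  proof (rule generated_byI[where h = "\<lambda>c. u c j"])
    fix i
    have "(\<Sum>s<k. t i s * p s j) = (\<Sum>s<k. \<Sum>c<q. t i s * w s c * u c j)"
      using less.prems by (simp add: fac sum_distrib_left mult.assoc)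
    also have "\<dots> = (\<Sum>c<q. (\<Sum>s<k. t i s * w s c) * u c j)"
      by (subst sum.swap) (simp add: sum_distrib_right)
    finally show "(\<Sum>s<k. t i s * p s j) = (\<Sum>c<q. (\<Sum>s<k. t i s * w s c) * u c j)" .
  qed
  moreover have "?gen (\<lambda>i. \<Sum>s\<in>{k..<j}. t i s * p s j)"
    using less by (intro generated_by_sum generated_by_mult_right) auto
  ultimately have "?gen (\<lambda>i. ((\<Sum>s<k. t i s * p s j) + (\<Sum>s\<in>{k..<j}. t i s * p s j)) * d j)"
    by (intro generated_by_add generated_by_mult_right)
  moreover have "t i j = ((\<Sum>s<k. t i s * p s j) + (\<Sum>s\<in>{k..<j}. t i s * p s j)) * d j"
    if "i \<in> {0..<k}" for i
    using that less.prems rec[of i j] sum.atLeastLessThan_concat[of 0 k j "\<lambda>s. t i s * p s j"]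
    by (simp add: atLeast0LessThan)
  ultimately show ?case by (rule generated_by_cong)
qed

lemma wy_T_block_generated:
  assumes A: "A \<in> carrier_mat n n" and k: "k \<le> n"
    and gen: "\<And>j. j < k \<Longrightarrow> generated_by q g {k..<n} (\<lambda>i. A $$ (i, j))"
  shows "\<exists>g'. \<forall>j. k \<le> j \<longrightarrow> j < n \<longrightarrow> generated_by q g' {0..<k} (\<lambda>i. wy_T A $$ (i, j))"
proof -
  let ?t = "\<lambda>i j. wy_T_lead A (n - 1) $$ (i, j)"
  have "\<forall>s. \<exists>h. s < k \<longrightarrow> (\<forall>i\<in>{k..<n}. hh_v A s $ i = (\<Sum>c<q. g i c * h c))"
    using hh_v_generated[OF A k _ gen] unfolding generated_by_def by blast
  then obtain w where w: "\<And>s i. s < k \<Longrightarrow> i \<in> {k..<n} \<Longrightarrow> hh_v A s $ i = (\<Sum>c<q. g i c * w s c)"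
    by metis
  have fac: "hh_v A s \<bullet> hh_v A j = (\<Sum>c<q. w s c * (\<Sum>i\<in>{k..<n}. g i c * hh_v A j $ i))"
    if "s < k" "k \<le> j" "j < n - 1" for s j
  proof -
    have "hh_v A s \<bullet> hh_v A j = (\<Sum>i\<in>{0..<n}. hh_v A s $ i * hh_v A j $ i)"
      using hh_v_carrier[OF A, of j] by (simp add: scalar_prod_def)
    \<comment> \<open>As \<open>j \<ge> k\<close>, the vector \<open>hh_v A j\<close> vanishes in
      the rows above \<open>k\<close>, so only the generated part of \<open>hh_v A s\<close>
      enters.\<close>
    also have "\<dots> = (\<Sum>i\<in>{k..<n}. hh_v A s $ i * hh_v A j $ i)"
      using that hh_v_index_above[OF A, of _ j] by (intro sum.mono_neutral_right) auto
    also have "\<dots> = (\<Sum>i\<in>{k..<n}. \<Sum>c<q. w s c * (g i c * hh_v A j $ i))"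
      using that by (simp add: w sum_distrib_left sum_distrib_right mult_ac)
    also have "\<dots> = (\<Sum>c<q. w s c * (\<Sum>i\<in>{k..<n}. g i c * hh_v A j $ i))"
      by (subst sum.swap) (simp add: sum_distrib_left)
    finally show ?thesis .
  qed
  have "generated_by q (\<lambda>i c. \<Sum>s<k. ?t i s * w s c) {0..<k} (\<lambda>i. wy_T A $$ (i, j))"
    if j: "k \<le> j" "j < n" for j
  \<comment> \<open>The recursion covers the columns of \<open>wy_T_lead\<close>; the one remaining
    column of \<open>wy_T\<close> is zero by definition.\<close>
  proof (cases "j < n - 1")
    case True
    have "?t i j = (\<Sum>s<j. ?t i s * (hh_v A s \<bullet> hh_v A j)) * - hh_tau A j"
      if "i < k" "k \<le> j" "j < n - 1" for i j
      using that by (subst wy_T_lead_index[OF A]) auto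
    then have "generated_by q (\<lambda>i c. \<Sum>s<k. ?t i s * w s c) {0..<k} (\<lambda>i. ?t i j)"
      by (rule column_recursion_generated[where N = "n - 1"
            and p = "\<lambda>s j. hh_v A s \<bullet> hh_v A j" and d = "\<lambda>j. - hh_tau A j", OF _ fac \<open>k \<le> j\<close> True])
    moreover have "wy_T A $$ (i, j) = ?t i j" if "i \<in> {0..<k}" for i
      using that True j A by (simp add: wy_T_def Let_def)
    ultimately show ?thesis by (rule generated_by_cong)
  next
    case False
    then have "wy_T A $$ (i, j) = 0" if "i \<in> {0..<k}" for i
      using that j A by (simp add: wy_T_def Let_def)
    then show ?thesis by (rule generated_by_cong[OF generated_by_zero])
  qed
  then show ?thesis by blast
qed

lemma wy_T_split:
  assumes A: "A \<in> carrier_mat n n"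
  shows "wy_T A = mat_diag n (\<lambda>i. if i < n - 1 then hh_tau A i else 0) + triu_strict (wy_T A)"
proof -
  have "wy_T_lead A (n - 1) $$ (i, i) = hh_tau A i" if "i < n - 1" for i
    using wy_T_lead_index[OF A that that] by simp
  moreover have "wy_T_lead A (n - 1) $$ (i, j) = 0" if "i < n - 1" "j < i" for i j
    using wy_T_lead_index[OF A, of i "n - 1" j] that by simp
  ultimately show ?thesis
    using A by (intro eq_matI) (auto simp: wy_T_def Let_def mat_diag_def triu_strict_def)
qed

lemma BPS_carrier: "A \<in> BPS n r p l m \<Longrightarrow> A \<in> carrier_mat n n"
  by (auto simp: BPS_def BM_def tril_strict_def triu_strict_def)

theorem theorem4:
  fixes A :: "real mat" and n r p l m :: nat
  assumes "A \<in> BPS n r p l m"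
  shows "wy_T A \<in> BPS_rank n 0 (r + l) 0 0 \<and>
         mat_diag n (\<lambda>i. if i < n - 1 then hh_tau A i else 0) \<in> BM n 0 0 \<and>
         wy_T A = mat_diag n (\<lambda>i. if i < n - 1 then hh_tau A i else 0) + triu_strict (wy_T A) \<and>
         (\<forall>k\<in>{1..n - 1}. mat_rank (submatrix (wy_T A) {0..<k} {k..<n}) \<le> r + l)"
proof -
  let ?D = "mat_diag n (\<lambda>i. if i < n - 1 then hh_tau A i else 0)"
  have A: "A \<in> carrier_mat n n" by (rule BPS_carrier[OF assms])
  have T: "wy_T A \<in> carrier_mat n n" using A by (simp add: wy_T_def Let_def)
  have D: "?D \<in> BM n 0 0" by (auto simp: BM_def mat_diag_def)
  note split = wy_T_split[OF A]
  have rank: "mat_rank (submatrix (wy_T A) {0..<k} {k..<n}) \<le> r + l" if k: "k \<le> n" for k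
  proof -
    obtain g where "\<And>j. j < k \<Longrightarrow> generated_by (r + l) g {k..<n} (\<lambda>i. A $$ (i, j))"
      using BPS_lower_block_generated[OF assms k] by blast
    then obtain g' where g': "\<And>j. k \<le> j \<Longrightarrow> j < n \<Longrightarrow>
        generated_by (r + l) g' {0..<k} (\<lambda>i. wy_T A $$ (i, j))"
      using wy_T_block_generated[OF A k] by blast
    have "{i \<in> {0..<k}. i < dim_row (wy_T A)} = {0..<k}" using T k by auto
    then show ?thesis using T g' by (intro mat_rank_submatrix_le[where g = g']) auto
  qed
  have zero: "mat_rank (submatrix (0\<^sub>m n n) I J) \<le> 0" for I J
    by (rule mat_rank_submatrix_le) (simp add: generated_by_def)
  have "wy_T A = ?D + tril_strict (0\<^sub>m n n) + triu_strict (wy_T A)"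
  proof -
    have "tril_strict (0\<^sub>m n n) = 0\<^sub>m n n" by (auto simp: tril_strict_def)
    then show ?thesis using split by (simp add: right_add_zero_mat[OF mat_diag_dim])
  qed
  \<comment> \<open>Lower rank 0 is witnessed by the zero matrix. For the upper part
    \<open>wy_T A\<close> itself serves: \<open>triu_strict\<close> removes its diagonal, which
    \<open>?D\<close> restores.\<close>
  then have "wy_T A \<in> BPS_rank n 0 (r + l) 0 0"
    unfolding BPS_rank_def using D T zero rank
    by (intro CollectI exI[of _ ?D] exI[of _ "0\<^sub>m n n"] exI[of _ "wy_T A"]) auto
  then show ?thesis using D split rank by auto
qed

end
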